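(* Let $\mathcal{H}=(V,H)$ be a boolean representable near-matroid and let $k\ge 0$. Then: (i) the truncation $\mathcal{H}_k$ is a BRSC; (ii) $\mathrm{pure}(\mathcal{H}_k)$ is a BRSC.
   Context: A simplicial complex is a pair $(V,H)$ with $V$ finite nonempty, $H\subseteq 2^V$ containing all singletons and closed under subsets; dimension is $\max\{|X|:X\in H\}-1$. A flat is a set $F\subseteq V$ with $X\cup\{p\}\in H$ for all $X\in H$, $X\subseteq F$, $p\in V\setminus F$; flats are closed under intersection and $\overline{X}$ denotes the intersection of all flats containing $X$. A complex is boolean representable (BRSC) if it admits a boolean matrix representation; equivalently, every face $\{x_1,\dots,x_k\}$ admits a chain of flats $F_0\subset\cdots\subset F_k$ with $x_i\in F_i\setminus F_{i-1}$ (for a suitable enumeration). $\mathcal{H}$ is a near-matroid if for all $X,Y\in H$, $\overline{X}=\overline{Y}\subsetneq V$ implies $|X|=|Y|$. The $k$-truncation is $\mathcal{H}_k=(V,H\cap P_{\le k}(V))$, where $P_{\le k}(V)$ is the set of subsets with at most $k$ elements. For a complex $(V,H)$ of dimension $d$, $\mathrm{pure}(V,H)=(V',H')$ where $V'$ is the union of all faces with $d+1$ elements and $H'$ is the set of all subsets of faces with $d+1$ elements.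
   Formalization: For k = 0 the truncation has no singleton faces and its pure part has empty vertex set, so neither is a simplicial complex; the full BRSC claim is stated for k ≥ 1, and for k = 0 only that both pairs admit a boolean matrix representation. *)

theory Defs
  imports Main
begin

type_synonym 'a cpx = "'a set \<times> 'a set set"

fun simplicial_complex :: "'a cpx \<Rightarrow> bool" where
  "simplicial_complex (V, H) \<longleftrightarrow>
     finite V \<and> V \<noteq> {} \<and> H \<subseteq> Pow V \<and> (\<forall>v\<in>V. {v} \<in> H) \<and>
     (\<forall>X\<in>H. \<forall>Y. Y \<subseteq> X \<longrightarrow> Y \<in> H)"

text \<open>Subsets of a nonempty face are faces, so the empty set is always a face and the maximum below
  is taken over a nonempty finite set.\<close>

fun cdim :: "'a cpx \<Rightarrow> int" where
  "cdim (V, H) = int (Max (card ` H)) - 1"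

fun flat :: "'a cpx \<Rightarrow> 'a set \<Rightarrow> bool" where
  "flat (V, H) F \<longleftrightarrow>
     F \<subseteq> V \<and> (\<forall>X\<in>H. X \<subseteq> F \<longrightarrow> (\<forall>p\<in>V - F. X \<union> {p} \<in> H))"

definition cl :: "'a cpx \<Rightarrow> 'a set \<Rightarrow> 'a set" where
  "cl K X = \<Inter>{F. flat K F \<and> X \<subseteq> F}"

text \<open>A boolean matrix with rows \<open>0, \<dots>, m - 1\<close> and columns indexed by vertices is a function
  \<open>M\<close>, whose entry \<open>1\<close> is \<open>True\<close>. A set \<open>X\<close> of columns is independent (over the superboolean
  semiring) if there is a square submatrix with column set \<open>X\<close> that becomes lower unitriangular
  after independent permutations of its rows and columns. The lists \<open>rs\<close> and \<open>cs\<close> give the rows and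
  columns in permuted order; for \<open>X = {}\<close> both are empty.\<close>

definition independent_columns :: "nat \<Rightarrow> (nat \<Rightarrow> 'a \<Rightarrow> bool) \<Rightarrow> 'a set \<Rightarrow> bool" where
  "independent_columns m M X \<longleftrightarrow>
     (\<exists>rs cs. distinct rs \<and> set rs \<subseteq> {..<m} \<and> distinct cs \<and> set cs = X \<and>
        length rs = length cs \<and>
        (\<forall>i<length cs. M (rs ! i) (cs ! i)) \<and>
        (\<forall>j<length cs. \<forall>i<j. \<not> M (rs ! i) (cs ! j)))"

fun boolean_representable :: "'a cpx \<Rightarrow> bool" where
  "boolean_representable (V, H) \<longleftrightarrow>
     (\<exists>m M. H = {X. X \<subseteq> V \<and> independent_columns m M X})"

definition BRSC :: "'a cpx \<Rightarrow> bool" where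
  "BRSC K \<longleftrightarrow> simplicial_complex K \<and> boolean_representable K"

fun near_matroid :: "'a cpx \<Rightarrow> bool" where
  "near_matroid (V, H) \<longleftrightarrow>
     (\<forall>X\<in>H. \<forall>Y\<in>H. cl (V, H) X = cl (V, H) Y \<and> cl (V, H) Y \<subset> V \<longrightarrow> card X = card Y)"

fun truncation :: "nat \<Rightarrow> 'a cpx \<Rightarrow> 'a cpx" where
  "truncation k (V, H) = (V, H \<inter> {X. X \<subseteq> V \<and> card X \<le> k})"

fun top_faces :: "'a cpx \<Rightarrow> 'a set set" where
  "top_faces (V, H) = {X \<in> H. int (card X) = cdim (V, H) + 1}"

definition pure_part :: "'a cpx \<Rightarrow> 'a cpx" where
  "pure_part K = (\<Union>(top_faces K), {Y. \<exists>X\<in>top_faces K. Y \<subseteq> X})"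

end

theory Submission
  imports Defs
begin

text \<open>Boolean representability amounts to the following: every nonempty face \<open>X\<close> has a vertex \<open>x\<close>
  and a flat containing \<open>X - {x}\<close> but not \<open>x\<close>. In a near-matroid, every face inside a proper flat
  \<open>cl A\<close> (\<open>A\<close> a face) extends, within \<open>cl A\<close>, to a face of cardinality \<open>card A\<close>; hence \<open>cl A\<close> remains
  a flat of the \<open>k\<close>-truncation when \<open>card A < k\<close>, which gives (i).

  For (ii), call a flat \<open>F\<close> good if \<open>Y \<union> {p}\<close> lies in a top face for every face \<open>Y \<subseteq> F\<close> and every
  vertex \<open>p\<close> outside \<open>F\<close>; good flats trace flats on the pure part. If \<open>B\<close> is a top face and
  \<open>b \<in> B - cl (B - {b})\<close>, then \<open>cl (B - {b})\<close> is good by the extension property. Moreover every flat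
  \<open>F\<close> below a proper good flat \<open>F'\<close> is good: for \<open>p \<notin> F'\<close> use \<open>Y \<subseteq> F'\<close>, and for \<open>p \<in> F'\<close> the face
  \<open>Y \<union> {p}\<close> lies in \<open>F'\<close>. So all flats needed for the subfaces of \<open>B\<close> can be found below
  \<open>cl (B - {b})\<close>.\<close>

section \<open>Boolean matrices and separation of faces by flats\<close>

lemma independent_columns_empty: "independent_columns m M {}"
  unfolding independent_columns_def by (intro exI[of _ "[]"]) auto

text \<open>Place row \<open>r\<close> and column \<open>x\<close> first: the entries of
  \<open>r\<close> on \<open>X\<close> are zero, so the enlarged submatrix stays lower
  unitriangular, whatever column \<open>x\<close> holds below. The row is new because every row in
  use has a one in a column of \<open>X\<close>.\<close>

lemma independent_columns_insert:
  assumes ind: "independent_columns m M X" and r: "r < m" "M r x"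
    and zero: "\<And>y. y \<in> X \<Longrightarrow> \<not> M r y"
  shows "independent_columns m M (insert x X)"
proof -
  obtain rs cs where *: "distinct rs" "set rs \<subseteq> {..<m}" "distinct cs" "set cs = X"
      "length rs = length cs" "\<forall>i<length cs. M (rs ! i) (cs ! i)"
      "\<forall>j<length cs. \<forall>i<j. \<not> M (rs ! i) (cs ! j)"
    using ind unfolding independent_columns_def by auto
  have "r \<notin> set rs"
    using * zero by (metis in_set_conv_nth)
  moreover have "x \<notin> set cs"
    using * zero r by auto
  ultimately show ?thesis
    unfolding independent_columns_def using * r zero
    by (intro exI[of _ "r # rs"] exI[of _ "x # cs"]) (auto simp: nth_Cons split: nat.splits)
qed

text \<open>In lower unitriangular form the first row vanishes on every column after the first.
  Deleting that row and its column keeps the form, which undoes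
  \<open>independent_columns_insert\<close>.\<close>

lemma independent_columns_remove:
  assumes "independent_columns m M X" and "X \<noteq> {}"
  obtains x r where "x \<in> X" "r < m" "M r x" "\<forall>y\<in>X - {x}. \<not> M r y"
    "independent_columns m M (X - {x})"
proof -
  obtain rs cs where *: "distinct rs" "set rs \<subseteq> {..<m}" "distinct cs" "set cs = X"
      "length rs = length cs" "\<forall>i<length cs. M (rs ! i) (cs ! i)"
      "\<forall>j<length cs. \<forall>i<j. \<not> M (rs ! i) (cs ! j)"
    using assms(1) unfolding independent_columns_def by auto
  obtain x cs' where cs: "cs = x # cs'"
    using * assms(2) by (cases cs) auto
  obtain r rs' where rs: "rs = r # rs'"
    using * cs by (cases rs) auto
  have "M r x"
    using *(6) cs rs by auto
  moreover have "\<forall>y\<in>X - {x}. \<not> M r y"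
  proof
    fix y assume that: "y \<in> X - {x}"
    have "y \<in> set cs'"
      using that * cs by auto
    then obtain j where "j < length cs'" "cs' ! j = y"
      by (auto simp: in_set_conv_nth)
    then show "\<not> M r y"
      using *(7)[rule_format, of "Suc j" 0] cs rs by simp
  qed
  moreover have "independent_columns m M (X - {x})"
    unfolding independent_columns_def
  proof (intro exI[of _ rs'] exI[of _ cs'] conjI)
    show "\<forall>i<length cs'. M (rs' ! i) (cs' ! i)"
      using *(6) cs rs by fastforce
    show "\<forall>j<length cs'. \<forall>i<j. \<not> M (rs' ! i) (cs' ! j)"
      using *(7) cs rs by fastforce
  qed (use * cs rs in auto)
  moreover have "x \<in> X" "r < m"
    using * cs rs by auto
  ultimately show thesis
    using that by blast
qed

lemma flat_insert:
  assumes "flat (V, H) F" "X \<in> H" "X \<subseteq> F" "p \<in> V" "p \<notin> F"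
  shows "insert p X \<in> H"
  using assms by simp

text \<open>The zero set of any row is a flat: by \<open>independent_columns_insert\<close>, a face
  inside it stays independent when a column with a one in that row is added. The row split off from
  \<open>X\<close> gives the flat that separates \<open>x\<close>.\<close>

lemma boolean_representable_flat:
  assumes rep: "boolean_representable (V, H)" and X: "X \<in> H" "X \<noteq> {}"
  obtains x F where "flat (V, H) F" "x \<in> X" "x \<notin> F" "X - {x} \<subseteq> F"
proof -
  obtain m M where H: "H = {X. X \<subseteq> V \<and> independent_columns m M X}"
    using rep by auto
  have "independent_columns m M X"
    using X(1) H by simp
  then obtain x r where x: "x \<in> X" "r < m" "M r x" "\<forall>y\<in>X - {x}. \<not> M r y"
      "independent_columns m M (X - {x})"
    using X(2) by (rule independent_columns_remove)
  let ?F = "{v \<in> V. \<not> M r v}"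
  have "flat (V, H) ?F"
    using H \<open>r < m\<close> by (auto intro!: independent_columns_insert)
  moreover have "x \<notin> ?F" "X - {x} \<subseteq> ?F"
    using x X H by auto
  ultimately show thesis
    using that x(1) by blast
qed

text \<open>The representing matrix has one row per flat, zero exactly on that flat. Inductively,
  \<open>sep\<close> supplies the row that makes a face independent; conversely, the first row of an
  independent set is a flat across which its first vertex can be adjoined.\<close>

lemma boolean_representableI:
  assumes fin: "finite V" and HV: "H \<subseteq> Pow V" and empty: "{} \<in> H"
    and down: "\<And>X Y. X \<in> H \<Longrightarrow> Y \<subseteq> X \<Longrightarrow> Y \<in> H"
    and sep: "\<And>X. X \<in> H \<Longrightarrow> X \<noteq> {} \<Longrightarrow> \<exists>x\<in>X. \<exists>F. flat (V, H) F \<and> x \<notin> F \<and> X - {x} \<subseteq> F"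
  shows "boolean_representable (V, H)"
proof -
  have "finite {F. flat (V, H) F}"
    by (rule finite_subset[of _ "Pow V"]) (use fin in auto)
  then obtain Fs where Fs: "set Fs = {F. flat (V, H) F}"
    using finite_list by blast
  let ?M = "\<lambda>i v. v \<notin> Fs ! i"
  have ind: "independent_columns (length Fs) ?M X" if "finite X" "X \<in> H" for X
    using that
  proof (induction X rule: finite_psubset_induct)
    case (psubset X)
    show ?case
    proof (cases "X = {}")
      case True
      then show ?thesis
        by (simp add: independent_columns_empty)
    next
      case False
      then obtain x F where x: "x \<in> X" "flat (V, H) F" "x \<notin> F" "X - {x} \<subseteq> F"
        using sep psubset.prems by blast
      then have "F \<in> set Fs"
        using Fs by blast
      then obtain i where i: "i < length Fs" "Fs ! i = F"
        by (auto simp: in_set_conv_nth)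
      have "independent_columns (length Fs) ?M (X - {x})"
      proof (rule psubset.IH)
        show "X - {x} \<subset> X"
          using x(1) by blast
        show "X - {x} \<in> H"
          using psubset.prems by (rule down) simp
      qed
      then have "independent_columns (length Fs) ?M (insert x (X - {x}))"
        by (rule independent_columns_insert) (use i x in auto)
      then show ?thesis
        using x(1) by (simp add: insert_absorb)
    qed
  qed
  have face: "X \<in> H" if "finite X" "X \<subseteq> V" "independent_columns (length Fs) ?M X" for X
    using that
  proof (induction X rule: finite_psubset_induct)
    case (psubset X)
    show ?case
    proof (cases "X = {}")
      case True
      then show ?thesis
        by (simp add: empty)
    next
      case False
      obtain x r where x: "x \<in> X" "r < length Fs" "x \<notin> Fs ! r"
          "\<forall>y\<in>X - {x}. \<not> y \<notin> Fs ! r" "independent_columns (length Fs) ?M (X - {x})"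
        using psubset.prems(2) False by (rule independent_columns_remove)
      have "X - {x} \<in> H"
      proof (rule psubset.IH[OF _ _ x(5)])
        show "X - {x} \<subset> X"
          using x(1) by blast
        show "X - {x} \<subseteq> V"
          using psubset.prems(1) by blast
      qed
      moreover have "flat (V, H) (Fs ! r)"
        using Fs x(2) nth_mem by blast
      moreover have "X - {x} \<subseteq> Fs ! r"
        using x(4) by blast
      moreover have "x \<in> V"
        using x(1) psubset.prems(1) by blast
      ultimately have "insert x (X - {x}) \<in> H"
        using x(3) flat_insert by metis
      then show ?thesis
        using x(1) by (simp add: insert_absorb)
    qed
  qed
  have "H = {X. X \<subseteq> V \<and> independent_columns (length Fs) ?M X}"
  proof (intro equalityI subsetI)
    fix X assume "X \<in> H"
    moreover from this have "X \<subseteq> V"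
      using HV by blast
    ultimately show "X \<in> {X. X \<subseteq> V \<and> independent_columns (length Fs) ?M X}"
      using ind[of X] finite_subset[OF _ fin] by simp
  next
    fix X assume "X \<in> {X. X \<subseteq> V \<and> independent_columns (length Fs) ?M X}"
    then show "X \<in> H"
      using face[of X] finite_subset[OF _ fin] by simp
  qed
  then show ?thesis
    unfolding boolean_representable.simps by (intro exI)
qed

section \<open>Closures and face extension in near-matroids\<close>

lemma cl_superset: "X \<subseteq> cl K X"
  unfolding cl_def by blast

lemma cl_least: "flat K F \<Longrightarrow> X \<subseteq> F \<Longrightarrow> cl K X \<subseteq> F"
  unfolding cl_def by blast

lemma flat_cl:
  assumes "X \<subseteq> V"
  shows "flat (V, H) (cl (V, H) X)"
  unfolding flat.simps
proof (intro conjI ballI impI)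
  show "cl (V, H) X \<subseteq> V"
    using assms by (intro cl_least) simp
  fix Y p assume Y: "Y \<in> H" "Y \<subseteq> cl (V, H) X" and p: "p \<in> V - cl (V, H) X"
  \<comment> \<open>One flat above \<open>X\<close> already omits \<open>p\<close>, and its flatness
    suffices because it contains the closure.\<close>
  obtain F where F: "flat (V, H) F" "X \<subseteq> F" "p \<notin> F"
    using p unfolding cl_def by blast
  have "Y \<subseteq> F"
    using Y(2) cl_least[OF F(1,2)] by (rule subset_trans)
  then have "insert p Y \<in> H"
    using flat_insert[OF F(1) Y(1)] F(3) p by blast
  then show "Y \<union> {p} \<in> H"
    by simp
qed

text \<open>A maximal face \<open>Z\<close> inside \<open>F\<close> spans it: a point of
  \<open>F\<close> outside the closure of \<open>Z\<close> could be adjoined to \<open>Z\<close>,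
  contradicting maximality.\<close>

lemma face_extends_to_spanning_face:
  assumes fin: "finite V" and HV: "H \<subseteq> Pow V" and F: "flat (V, H) F" and Y: "Y \<in> H" "Y \<subseteq> F"
  obtains Z where "Z \<in> H" "Y \<subseteq> Z" "Z \<subseteq> F" "cl (V, H) Z = F"
proof -
  let ?S = "{Z \<in> H. Z \<subseteq> F}"
  have "finite H"
    using HV fin by (simp add: finite_subset)
  then have "finite ?S"
    by simp
  moreover have "Y \<in> ?S"
    using Y by simp
  ultimately have "\<exists>Z\<in>?S. Y \<subseteq> Z \<and> (\<forall>W\<in>?S. Z \<subseteq> W \<longrightarrow> Z = W)"
    by (rule finite_has_maximal2)
  then obtain Z where Z: "Z \<in> ?S" "Y \<subseteq> Z" and max: "\<forall>W\<in>?S. Z \<subseteq> W \<longrightarrow> Z = W"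
    by (elim bexE conjE)
  have flatZ: "flat (V, H) (cl (V, H) Z)"
    using Z(1) HV by (intro flat_cl) blast
  have "F \<subseteq> cl (V, H) Z"
  proof
    fix p assume p: "p \<in> F"
    show "p \<in> cl (V, H) Z"
    proof (rule ccontr)
      assume np: "p \<notin> cl (V, H) Z"
      have "p \<in> V"
        using F p by auto
      moreover have "Z \<in> H"
        using Z(1) by simp
      ultimately have "insert p Z \<in> H"
        using flat_insert[OF flatZ _ cl_superset _ np] by simp
      then have "insert p Z \<in> ?S"
        using Z(1) p by simp
      then have "Z = insert p Z"
        using max subset_insertI by blast
      then show False
        using np cl_superset[of Z "(V, H)"] by blast
    qed
  qed
  moreover have "cl (V, H) Z \<subseteq> F"
    using cl_least[OF F, of Z] Z(1) by simp
  ultimately have "cl (V, H) Z = F"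
    by simp
  then show thesis
    using that[of Z] Z by simp
qed

text \<open>A face that spans \<open>cl A\<close> and contains \<open>Y\<close> has the same closure
  as \<open>A\<close>, which is proper, so the near-matroid condition fixes its cardinality.\<close>

lemma near_matroid_extend_face:
  assumes "finite V" "H \<subseteq> Pow V" and near: "near_matroid (V, H)"
    and A: "A \<in> H" "cl (V, H) A \<subset> V" and Y: "Y \<in> H" "Y \<subseteq> cl (V, H) A"
  obtains Z where "Z \<in> H" "Y \<subseteq> Z" "Z \<subseteq> cl (V, H) A" "card Z = card A"
proof -
  have "flat (V, H) (cl (V, H) A)"
    using assms(2) A(1) by (intro flat_cl) auto
  then obtain Z where Z: "Z \<in> H" "Y \<subseteq> Z" "Z \<subseteq> cl (V, H) A" "cl (V, H) Z = cl (V, H) A"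
    using Y by (rule face_extends_to_spanning_face[OF assms(1,2)])
  then have "card Z = card A"
    using near A unfolding near_matroid.simps by blast
  then show thesis
    using that[of Z] Z by simp
qed

section \<open>Flats that survive truncation\<close>

text \<open>Faces inside \<open>cl A\<close> have at most \<open>card A\<close> elements, which is
  less than \<open>k\<close>, so adjoining one vertex cannot exceed the truncation bound.\<close>

lemma near_matroid_flat_truncation:
  assumes fin: "finite V" and HV: "H \<subseteq> Pow V" and near: "near_matroid (V, H)"
    and A: "A \<in> H" "cl (V, H) A \<subset> V" "card A < k"
  shows "flat (truncation k (V, H)) (cl (V, H) A)"
proof -
  have F: "flat (V, H) (cl (V, H) A)"
    using HV A(1) by (intro flat_cl) auto
  have ext: "Y \<union> {p} \<in> H \<and> Y \<union> {p} \<subseteq> V \<and> card (Y \<union> {p}) \<le> k"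
    if Y: "Y \<in> H" "Y \<subseteq> cl (V, H) A" and p: "p \<in> V - cl (V, H) A" for Y p
  proof -
    obtain Z where Z: "Z \<in> H" "Y \<subseteq> Z" "Z \<subseteq> cl (V, H) A" "card Z = card A"
      by (rule near_matroid_extend_face[OF fin HV near A(1,2) Y])
    have "finite Z"
      using Z(1) HV fin finite_subset by blast
    then have "card Y \<le> card A"
      using card_mono[of Z Y] Z(2,4) by simp
    then have "card (Y \<union> {p}) \<le> k"
      using A(3) card_Un_le[of Y "{p}"] by simp
    moreover have "Y \<union> {p} \<in> H"
      using F Y p by simp
    ultimately show ?thesis
      using HV by blast
  qed
  show ?thesis
    unfolding truncation.simps flat.simps
  proof (intro conjI ballI impI)
    show "cl (V, H) A \<subseteq> V"
      using A(2) by (rule psubset_imp_subset)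
    fix Y p
    assume "Y \<in> H \<inter> {X. X \<subseteq> V \<and> card X \<le> k}" "Y \<subseteq> cl (V, H) A" "p \<in> V - cl (V, H) A"
    then show "Y \<union> {p} \<in> H \<inter> {X. X \<subseteq> V \<and> card X \<le> k}"
      using ext[of Y p] by blast
  qed
qed

section \<open>Good flats and their traces on the pure part\<close>

fun good_flat :: "'a cpx \<Rightarrow> 'a set set \<Rightarrow> 'a set \<Rightarrow> bool" where
  "good_flat (V, H) T F \<longleftrightarrow>
     flat (V, H) F \<and> (\<forall>Y\<in>H. Y \<subseteq> F \<longrightarrow> (\<forall>p\<in>V - F. \<exists>B\<in>T. insert p Y \<subseteq> B))"

lemma good_flat_flat: "good_flat (V, H) T F \<Longrightarrow> flat (V, H) F"
  by simp

lemma good_flat_top_face: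
  assumes "good_flat (V, H) T F" "Y \<in> H" "Y \<subseteq> F" "p \<in> V" "p \<notin> F"
  obtains B where "B \<in> T" "insert p Y \<subseteq> B"
proof -
  have "\<exists>B\<in>T. insert p Y \<subseteq> B"
    using assms unfolding good_flat.simps by (meson DiffI)
  then show thesis
    using that by blast
qed

lemma good_flat_below:
  assumes good: "good_flat (V, H) T F'" and "F' \<subset> V" and F: "flat (V, H) F" "F \<subseteq> F'"
  shows "good_flat (V, H) T F"
  unfolding good_flat.simps
proof (intro conjI ballI impI)
  fix Y p assume Y: "Y \<in> H" "Y \<subseteq> F" and p: "p \<in> V - F"
  show "\<exists>B\<in>T. insert p Y \<subseteq> B"
  proof (cases "p \<in> F'")
    case True
    \<comment> \<open>Since \<open>p\<close> lies in \<open>F'\<close>, goodness of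
      \<open>F'\<close> says nothing about \<open>p\<close> directly. An auxiliary vertex
      \<open>q\<close> outside \<open>F'\<close> puts the face \<open>insert p Y\<close> below a top
      face.\<close>
    obtain q where q: "q \<in> V" "q \<notin> F'"
      using assms(2) by blast
    have "insert p Y \<in> H"
      using flat_insert[OF F(1) Y] p by blast
    moreover have "insert p Y \<subseteq> F'"
      using Y True F(2) by blast
    ultimately obtain B where "B \<in> T" "insert q (insert p Y) \<subseteq> B"
      using q by (rule good_flat_top_face[OF good])
    then show ?thesis
      by blast
  next
    case False
    have "Y \<subseteq> F'" "p \<in> V"
      using Y F(2) p by blast+
    then obtain B where "B \<in> T" "insert p Y \<subseteq> B"
      using False by (rule good_flat_top_face[OF good Y(1)])
    then show ?thesis
      by blast
  qed
qed (rule F(1))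

text \<open>Subsets of members of \<open>T\<close> are faces of \<open>H\<close>, and a vertex of
  the union of \<open>T\<close> outside the trace lies outside \<open>F\<close>. Goodness then gives
  a member of \<open>T\<close> containing both, as flatness in the generated complex
  demands.\<close>

lemma good_flat_trace:
  assumes good: "good_flat (V, H) T F" and T: "T \<subseteq> H" "H \<subseteq> Pow V"
    and down: "\<And>X Y. X \<in> H \<Longrightarrow> Y \<subseteq> X \<Longrightarrow> Y \<in> H"
  shows "flat (\<Union>T, {Y. \<exists>X\<in>T. Y \<subseteq> X}) (F \<inter> \<Union>T)"
  unfolding flat.simps
proof (intro conjI ballI impI)
  fix Y p assume Y: "Y \<in> {Y. \<exists>X\<in>T. Y \<subseteq> X}" "Y \<subseteq> F \<inter> \<Union>T" and p: "p \<in> \<Union>T - F \<inter> \<Union>T"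
  obtain X where X: "X \<in> T" "Y \<subseteq> X"
    using Y(1) by blast
  have "Y \<in> H"
    using X T(1) down[of X Y] by blast
  moreover have "Y \<subseteq> F" "p \<in> V" "p \<notin> F"
    using Y(2) p T by blast+
  ultimately obtain B where "B \<in> T" "insert p Y \<subseteq> B"
    by (rule good_flat_top_face[OF good])
  then show "Y \<union> {p} \<in> {Y. \<exists>X\<in>T. Y \<subseteq> X}"
    by auto
qed simp

lemma near_matroid_good_flat:
  assumes fin: "finite V" and HV: "H \<subseteq> Pow V" and near: "near_matroid (V, H)"
    and A: "A \<in> H" "cl (V, H) A \<subset> V"
  shows "good_flat (V, H) {X \<in> H. card X = Suc (card A)} (cl (V, H) A)"
  unfolding good_flat.simps
proof (intro conjI ballI impI)
  show F: "flat (V, H) (cl (V, H) A)"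
    using HV A(1) by (intro flat_cl) auto
  fix Y p assume Y: "Y \<in> H" "Y \<subseteq> cl (V, H) A" and p: "p \<in> V - cl (V, H) A"
  obtain Z where Z: "Z \<in> H" "Y \<subseteq> Z" "Z \<subseteq> cl (V, H) A" "card Z = card A"
    by (rule near_matroid_extend_face[OF fin HV near A Y])
  have "finite Z"
    using Z(1) HV fin finite_subset by blast
  moreover have "p \<notin> Z"
    using Z p by blast
  ultimately have "card (insert p Z) = Suc (card A)"
    using Z(4) by simp
  moreover have "insert p Z \<in> H"
    using flat_insert[OF F Z(1,3)] p by blast
  ultimately show "\<exists>B\<in>{X \<in> H. card X = Suc (card A)}. insert p Y \<subseteq> B"
    using Z(2) by blast
qed

section \<open>Representability of the truncation and of its pure part\<close>

lemma simplicial_complexD: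
  assumes "simplicial_complex (V, H)"
  shows "finite V" "H \<subseteq> Pow V" "{} \<in> H" "\<And>X Y. X \<in> H \<Longrightarrow> Y \<subseteq> X \<Longrightarrow> Y \<in> H"
proof -
  have *: "finite V" "V \<noteq> {}" "H \<subseteq> Pow V" "\<forall>v\<in>V. {v} \<in> H" "\<forall>X\<in>H. \<forall>Y. Y \<subseteq> X \<longrightarrow> Y \<in> H"
    using assms unfolding simplicial_complex.simps by - (elim conjE, assumption)+
  show "finite V" "H \<subseteq> Pow V"
    by (fact *)+
  show down: "Y \<in> H" if "X \<in> H" "Y \<subseteq> X" for X Y
    using *(5) that by simp
  obtain v where "v \<in> V"
    using *(2) by blast
  then have "{v} \<in> H"
    using *(4) by simp
  then show "{} \<in> H"
    by (rule down) simp
qed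

lemma near_matroid_truncation_boolean_representable:
  assumes BR: "BRSC (V, H)" and near: "near_matroid (V, H)"
  shows "boolean_representable (truncation k (V, H))"
proof -
  have sc: "simplicial_complex (V, H)" and rep: "boolean_representable (V, H)"
    using BR by (simp_all only: BRSC_def)
  note fin = simplicial_complexD(1)[OF sc] and HV = simplicial_complexD(2)[OF sc]
    and down = simplicial_complexD(4)[OF sc]
  have empty: "{} \<in> H"
    using sc by (rule simplicial_complexD)
  have "boolean_representable (V, H \<inter> {X. X \<subseteq> V \<and> card X \<le> k})"
  proof (rule boolean_representableI)
    fix X Y assume X: "X \<in> H \<inter> {X. X \<subseteq> V \<and> card X \<le> k}" and "Y \<subseteq> X"
    have "finite X"
      using X finite_subset[OF _ fin] by simp
    then have "card Y \<le> card X"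
      using \<open>Y \<subseteq> X\<close> by (rule card_mono)
    moreover have "Y \<in> H"
      using X \<open>Y \<subseteq> X\<close> down[of X Y] by simp
    moreover have "Y \<subseteq> V"
      using X \<open>Y \<subseteq> X\<close> by blast
    ultimately show "Y \<in> H \<inter> {X. X \<subseteq> V \<and> card X \<le> k}"
      using X by simp
  next
    fix X assume X: "X \<in> H \<inter> {X. X \<subseteq> V \<and> card X \<le> k}" and "X \<noteq> {}"
    have "X \<in> H"
      using X by simp
    then obtain x F where x: "flat (V, H) F" "x \<in> X" "x \<notin> F" "X - {x} \<subseteq> F"
      using \<open>X \<noteq> {}\<close> by (rule boolean_representable_flat[OF rep])
    \<comment> \<open>The flat \<open>F\<close> is replaced by the smaller closure of
      \<open>?A\<close>: it still omits \<open>x\<close>, hence is proper, and it is spanned by a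
      face with fewer than \<open>k\<close> elements.\<close>
    let ?A = "X - {x}"
    have sub: "cl (V, H) ?A \<subseteq> F"
      using x(1,4) by (rule cl_least)
    have "x \<in> V"
      using x(2) X by blast
    have "finite X"
      using X finite_subset[OF _ fin] by simp
    have "cl (V, H) ?A \<subset> V"
    proof (rule psubsetI)
      show "cl (V, H) ?A \<subseteq> V"
        using sub x(1) by auto
      show "cl (V, H) ?A \<noteq> V"
        using sub x(3) \<open>x \<in> V\<close> by blast
    qed
    moreover have "card ?A < k"
      using card_Diff1_less[OF \<open>finite X\<close> x(2)] X by simp
    moreover have "?A \<in> H"
      using \<open>X \<in> H\<close> by (rule down) simp
    ultimately have "flat (truncation k (V, H)) (cl (V, H) ?A)"
      using near_matroid_flat_truncation[OF fin HV near] by simp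
    then have "flat (V, H \<inter> {X. X \<subseteq> V \<and> card X \<le> k}) (cl (V, H) ?A)"
      by (simp only: truncation.simps)
    moreover have "x \<notin> cl (V, H) ?A"
      using sub x(3) by blast
    ultimately show "\<exists>x\<in>X. \<exists>F. flat (V, H \<inter> {X. X \<subseteq> V \<and> card X \<le> k}) F \<and> x \<notin> F \<and> X - {x} \<subseteq> F"
      using x(2) cl_superset by (intro bexI[of _ x] exI[of _ "cl (V, H) ?A"] conjI)
  qed (use fin HV empty in auto)
  then show ?thesis
    by simp
qed

text \<open>The cardinality \<open>t\<close> need not be maximal in \<open>H\<close>, so the pure
  part of a truncation is covered while all closures are taken in \<open>(V, H)\<close>.\<close>

lemma near_matroid_pure_boolean_representable:
  assumes BR: "BRSC (V, H)" and near: "near_matroid (V, H)"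
    and T: "T = {X \<in> H. card X = t}" "T \<noteq> {}"
  shows "boolean_representable (\<Union>T, {Y. \<exists>X\<in>T. Y \<subseteq> X})"
proof -
  have sc: "simplicial_complex (V, H)" and rep: "boolean_representable (V, H)"
    using BR by (simp_all only: BRSC_def)
  note fin = simplicial_complexD(1)[OF sc] and HV = simplicial_complexD(2)[OF sc]
    and down = simplicial_complexD(4)[OF sc]
  have TH: "T \<subseteq> H"
    using T by auto
  show ?thesis
  proof (rule boolean_representableI)
    have "\<Union>T \<subseteq> V"
      using TH HV by blast
    then show "finite (\<Union>T)"
      using fin by (rule finite_subset)
  next
    fix X assume "X \<in> {Y. \<exists>X\<in>T. Y \<subseteq> X}" and ne: "X \<noteq> {}"
    then obtain B where B: "B \<in> T" "X \<subseteq> B"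
      by blast
    have BH: "B \<in> H" "B \<noteq> {}" "card B = t" "X \<in> H" "B \<subseteq> V"
      using B T(1) ne HV down[of B X] by auto
    \<comment> \<open>The vertex \<open>b\<close> is split off from the whole top face
      \<open>B\<close>, so that the good flat \<open>?F'\<close> bounds the flats needed for every
      subface of \<open>B\<close>.\<close>
    obtain b F0 where b: "flat (V, H) F0" "b \<in> B" "b \<notin> F0" "B - {b} \<subseteq> F0"
      using BH(1,2) by (rule boolean_representable_flat[OF rep])
    let ?F' = "cl (V, H) (B - {b})"
    have F'_sub: "?F' \<subseteq> F0"
      using b(1,4) by (rule cl_least)
    have F'_proper: "?F' \<subset> V"
    proof (rule psubsetI)
      show "?F' \<subseteq> V"
        using F'_sub b(1) by auto
      show "?F' \<noteq> V"
        using F'_sub b(2,3) BH(5) by blast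
    qed
    have "finite B"
      using BH fin finite_subset by blast
    then have "t = Suc (card (B - {b}))"
      using card.remove[OF _ b(2)] BH(3) by simp
    moreover have "B - {b} \<in> H"
      using BH(1) by (rule down) simp
    ultimately have good': "good_flat (V, H) T ?F'"
      using near_matroid_good_flat[OF fin HV near _ F'_proper] T(1) by metis
    have "\<exists>x\<in>X. \<exists>F. good_flat (V, H) T F \<and> x \<notin> F \<and> X - {x} \<subseteq> F"
    proof (cases "b \<in> X")
      case True
      have "X - {b} \<subseteq> ?F'"
        using B(2) cl_superset[of "B - {b}" "(V, H)"] by blast
      moreover have "b \<notin> ?F'"
        using F'_sub b(3) by blast
      ultimately show ?thesis
        using True good' by (intro bexI[of _ b] exI[of _ ?F'] conjI)
    next
      case False
      \<comment> \<open>Here \<open>X\<close> lies in \<open>B - {b}\<close>, so \<open>?F'\<close>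
        contains all of \<open>X\<close> and separates nothing. The closure of
        \<open>X - {x}\<close> lies below \<open>?F'\<close> and inherits goodness.\<close>
      obtain x F1 where x: "flat (V, H) F1" "x \<in> X" "x \<notin> F1" "X - {x} \<subseteq> F1"
        using BH(4) ne by (rule boolean_representable_flat[OF rep])
      let ?F = "cl (V, H) (X - {x})"
      have "flat (V, H) ?F"
        using BH(5) B(2) by (intro flat_cl) blast
      moreover have "?F \<subseteq> ?F'"
      proof (rule cl_least)
        show "flat (V, H) ?F'"
          using good' by (rule good_flat_flat)
        show "X - {x} \<subseteq> ?F'"
          using False B(2) cl_superset[of "B - {b}" "(V, H)"] by blast
      qed
      ultimately have "good_flat (V, H) T ?F"
        by (rule good_flat_below[OF good' F'_proper])
      moreover have "x \<notin> ?F"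
        using cl_least[OF x(1,4)] x(3) by blast
      ultimately show ?thesis
        using x(2) cl_superset by (intro bexI[of _ x] exI[of _ ?F] conjI)
    qed
    then obtain x F where x: "x \<in> X" "good_flat (V, H) T F" "x \<notin> F" "X - {x} \<subseteq> F"
      by (elim bexE exE conjE)
    have "flat (\<Union>T, {Y. \<exists>X\<in>T. Y \<subseteq> X}) (F \<inter> \<Union>T)"
      using good_flat_trace[OF x(2) TH HV down] .
    moreover have "X - {x} \<subseteq> F \<inter> \<Union>T"
      using x(4) B by blast
    moreover have "x \<notin> F \<inter> \<Union>T"
      using x(3) by blast
    ultimately show "\<exists>x\<in>X. \<exists>F. flat (\<Union>T, {Y. \<exists>X\<in>T. Y \<subseteq> X}) F \<and> x \<notin> F \<and> X - {x} \<subseteq> F"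
      using x(1) by (intro bexI[of _ x] exI[of _ "F \<inter> \<Union>T"] conjI)
  qed (use T in auto)
qed

section \<open>Simplicial complex axioms and conclusion\<close>

lemma simplicial_complex_truncation:
  assumes sc: "simplicial_complex (V, H)" and "k \<ge> 1"
  shows "simplicial_complex (truncation k (V, H))"
  unfolding truncation.simps simplicial_complex.simps
proof (intro conjI ballI allI impI)
  show "finite V" "V \<noteq> {}" "H \<inter> {X. X \<subseteq> V \<and> card X \<le> k} \<subseteq> Pow V"
    using sc by auto
  show "{v} \<in> H \<inter> {X. X \<subseteq> V \<and> card X \<le> k}" if "v \<in> V" for v
    using sc that assms(2) by simp
  fix X Y assume X: "X \<in> H \<inter> {X. X \<subseteq> V \<and> card X \<le> k}" and "Y \<subseteq> X"
  have "finite X"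
    using X finite_subset[OF _ simplicial_complexD(1)[OF sc]] by simp
  then have "card Y \<le> card X"
    using \<open>Y \<subseteq> X\<close> by (rule card_mono)
  moreover have "Y \<in> H"
    using simplicial_complexD(4)[OF sc _ \<open>Y \<subseteq> X\<close>] X by simp
  ultimately show "Y \<in> H \<inter> {X. X \<subseteq> V \<and> card X \<le> k}"
    using X \<open>Y \<subseteq> X\<close> by auto
qed

lemma top_faces_eq: "top_faces (V, H) = {X \<in> H. card X = Max (card ` H)}"
  by auto

lemma top_faces_nonempty:
  assumes "finite H" "H \<noteq> {}"
  shows "top_faces (V, H) \<noteq> {}"
proof -
  have "Max (card ` H) \<in> card ` H"
    using assms by (intro Max_in) auto
  then show ?thesis
    unfolding top_faces_eq by auto
qed

lemma simplicial_complex_pure_part: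
  assumes sc: "simplicial_complex (V, H)"
  shows "simplicial_complex (pure_part (V, H))"
proof -
  let ?T = "top_faces (V, H)"
  note HV = simplicial_complexD(2)[OF sc]
  have fin: "finite V" "finite H"
    using simplicial_complexD(1,2)[OF sc] finite_subset[of H "Pow V"] by simp_all
  obtain v where v: "{v} \<in> H"
    using sc by auto
  \<comment> \<open>A singleton face forces top faces to be nonempty sets, so the vertex set of the
    pure part is nonempty.\<close>
  have "card {v} \<le> Max (card ` H)"
    using v fin(2) by (intro Max_ge imageI finite_imageI)
  then have "{} \<notin> ?T"
    unfolding top_faces_eq by simp
  moreover have "?T \<noteq> {}"
    using v fin(2) by (intro top_faces_nonempty) auto
  ultimately have "\<Union>?T \<noteq> {}"
    by auto
  moreover have "\<Union>?T \<subseteq> V"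
    using HV unfolding top_faces_eq by blast
  then have "finite (\<Union>?T)"
    using fin(1) by (rule finite_subset)
  ultimately show ?thesis
    unfolding pure_part_def simplicial_complex.simps by (intro conjI) blast+
qed

(* The 0-truncation (V, {{}}) has no singleton faces and its pure part is ({}, {{}}), so for k = 0
   these pairs are not simplicial complexes in the strict sense; what remains of "is a BRSC" there
   is that the pair is given by a boolean matrix. *)
theorem theorem7p10:
  fixes V :: "'a set" and H :: "'a set set" and k :: nat
  assumes "BRSC (V, H)"
    and "near_matroid (V, H)"
  shows "(boolean_representable (truncation k (V, H)) \<and>
          (k \<ge> 1 \<longrightarrow> BRSC (truncation k (V, H)))) \<and>
         (boolean_representable (pure_part (truncation k (V, H))) \<and>
          (k \<ge> 1 \<longrightarrow> BRSC (pure_part (truncation k (V, H)))))"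
proof -
  let ?Hk = "H \<inter> {X. X \<subseteq> V \<and> card X \<le> k}"
  let ?T = "top_faces (V, ?Hk)"
  have sc: "simplicial_complex (V, H)"
    using assms(1) by (simp only: BRSC_def)
  have trunc: "boolean_representable (truncation k (V, H))"
    using assms by (rule near_matroid_truncation_boolean_representable)
  have fin: "finite ?Hk"
    using simplicial_complexD(1,2)[OF sc] finite_subset[of H "Pow V"] by simp
  have ne: "?Hk \<noteq> {}"
    using simplicial_complexD(3)[OF sc] by auto
  \<comment> \<open>The maximum is attained, hence at most \<open>k\<close>; the top faces of the
    truncation are therefore all faces of \<open>H\<close> of that one cardinality.\<close>
  have "Max (card ` ?Hk) \<in> card ` ?Hk"
    using fin ne by (intro Max_in) auto
  then have "Max (card ` ?Hk) \<le> k"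
    by auto
  then have "?T = {X \<in> H. card X = Max (card ` ?Hk)}"
    unfolding top_faces_eq using simplicial_complexD(2)[OF sc] by auto
  then have "boolean_representable (\<Union>?T, {Y. \<exists>X\<in>?T. Y \<subseteq> X})"
    using top_faces_nonempty[OF fin ne] by (rule near_matroid_pure_boolean_representable[OF assms])
  then have pure: "boolean_representable (pure_part (truncation k (V, H)))"
    by (simp only: pure_part_def truncation.simps)
  have "simplicial_complex (pure_part (truncation k (V, H)))" if "k \<ge> 1"
    using simplicial_complex_truncation[OF sc that] unfolding truncation.simps
    by (rule simplicial_complex_pure_part)
  then show ?thesis
    using trunc pure simplicial_complex_truncation[OF sc] unfolding BRSC_def by (intro conjI impI)
qed

end
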